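(* In the graceful game, Alice has a winning strategy on the complete graph $K_3$ and Bob has a winning strategy on the complete graph $K_4$, no matter who starts.
   Context: A graceful labeling of a graph $G$ with $m$ edges is an injective map $f\colon V(G)\to\{0,1,\dots,m\}$ such that the induced edge labels $|f(u)-f(v)|$, $uv\in E(G)$, are pairwise distinct. The graceful game on a simple graph $G$ with $m$ edges: two players, Alice and Bob, alternately choose a free (not yet labeled) vertex and assign to it a label from $\{0,1,\dots,m\}$ not yet used. An edge both of whose endpoints are labeled gets label $|f(u)-f(v)|$; a move is legal only if after it all edge labels are pairwise distinct. Alice wins if the whole graph ends up gracefully labeled; Bob wins if he can prevent this. Either player may be the first to move. *)

theory Defs
  imports Main
begin

record 'a graph =
  verts :: "'a set"
  edges :: "'a set set"

definition simple_graph :: "'a graph \<Rightarrow> bool" where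
  "simple_graph G \<longleftrightarrow> finite (verts G) \<and> (\<forall>e\<in>edges G. e \<subseteq> verts G \<and> card e = 2)"

definition complete_graph :: "nat \<Rightarrow> 'a graph \<Rightarrow> bool" where
  "complete_graph n G \<longleftrightarrow> simple_graph G \<and> card (verts G) = n \<and>
     (\<forall>u\<in>verts G. \<forall>v\<in>verts G. u \<noteq> v \<longrightarrow> {u, v} \<in> edges G)"

definition distinct_edge_labels :: "'a set set \<Rightarrow> ('a \<Rightarrow> nat) \<Rightarrow> bool" where
  "distinct_edge_labels F f \<longleftrightarrow>
     (\<forall>u v x y. {u, v} \<in> F \<and> {x, y} \<in> F \<and> {u, v} \<noteq> {x, y} \<longrightarrow>
        \<bar>int (f u) - int (f v)\<bar> \<noteq> \<bar>int (f x) - int (f y)\<bar>)"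

definition graceful_labeling :: "'a graph \<Rightarrow> ('a \<Rightarrow> nat) \<Rightarrow> bool" where
  "graceful_labeling G f \<longleftrightarrow>
     inj_on f (verts G) \<and> f ` verts G \<subseteq> {0..card (edges G)} \<and>
     distinct_edge_labels (edges G) f"

datatype player = Alice | Bob

fun opponent :: "player \<Rightarrow> player" where
  "opponent Alice = Bob"
| "opponent Bob = Alice"

type_synonym 'a position = "'a \<rightharpoonup> nat"
type_synonym 'a move = "'a \<times> nat"

definition legal_move :: "'a graph \<Rightarrow> 'a position \<Rightarrow> 'a move \<Rightarrow> bool" where
  "legal_move G p m \<longleftrightarrow> (case m of (v, l) \<Rightarrow>
     v \<in> verts G \<and> v \<notin> dom p \<and> l \<in> {0..card (edges G)} \<and> l \<notin> ran p \<and>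
     (let q = p(v \<mapsto> l)
      in distinct_edge_labels {e \<in> edges G. e \<subseteq> dom q} (the \<circ> q)))"

definition game_over :: "'a graph \<Rightarrow> 'a position \<Rightarrow> bool" where
  "game_over G p \<longleftrightarrow> (\<nexists>m. legal_move G p m)"

text \<open>The winner of a finished game; a game that ends with a free vertex left is won by Bob.\<close>

fun wins :: "'a graph \<Rightarrow> 'a position \<Rightarrow> player \<Rightarrow> bool" where
  "wins G p Alice \<longleftrightarrow> dom p = verts G \<and> graceful_labeling G (the \<circ> p)"
| "wins G p Bob \<longleftrightarrow> \<not> (dom p = verts G \<and> graceful_labeling G (the \<circ> p))"

text \<open>A history lists the moves made so far in chronological order. Its moves concern pairwise
  distinct vertices, so the position reached is \<^term>\<open>map_of h\<close>.\<close>

type_synonym 'a history = "'a move list"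
type_synonym 'a strategy = "'a history \<Rightarrow> 'a move"

definition to_move :: "player \<Rightarrow> 'a history \<Rightarrow> player" where
  "to_move s h = (if even (length h) then s else opponent s)"

inductive consistent_play ::
  "'a graph \<Rightarrow> player \<Rightarrow> player \<Rightarrow> 'a strategy \<Rightarrow> 'a history \<Rightarrow> bool"
  for G :: "'a graph" and s :: player and P :: player and \<sigma> :: "'a strategy" where
  start: "consistent_play G s P \<sigma> []"
| step: "\<lbrakk>consistent_play G s P \<sigma> h; legal_move G (map_of h) m;
          to_move s h = P \<longrightarrow> m = \<sigma> h\<rbrakk>
         \<Longrightarrow> consistent_play G s P \<sigma> (h @ [m])"

text \<open>In the game on \<open>G\<close> started by \<open>s\<close>, the strategy \<open>\<sigma>\<close> of player \<open>P\<close> always makes a legal move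
  when there is one, and every finished play in which \<open>P\<close> follows \<open>\<sigma>\<close> is won by \<open>P\<close>. The first
  condition is needed because a play in which \<open>\<sigma>\<close> proposes an illegal move cannot be continued
  and so never counts as finished. On a finite graph every play finishes.\<close>

definition winning_strategy ::
  "'a graph \<Rightarrow> player \<Rightarrow> player \<Rightarrow> 'a strategy \<Rightarrow> bool" where
  "winning_strategy G s P \<sigma> \<longleftrightarrow>
     (\<forall>h. consistent_play G s P \<sigma> h \<longrightarrow>
        (if game_over G (map_of h) then wins G (map_of h) P
         else to_move s h = P \<longrightarrow> legal_move G (map_of h) (\<sigma> h)))"

definition has_winning_strategy :: "'a graph \<Rightarrow> player \<Rightarrow> player \<Rightarrow> bool" where
  "has_winning_strategy G s P \<longleftrightarrow> (\<exists>\<sigma>. winning_strategy G s P \<sigma>)"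

end

theory Submission
  imports Defs
begin

text \<open>On a complete graph the state of the game is determined by the set \<open>L\<close> of used labels:
  a move is legal iff \<open>L\<close> stays a Golomb ruler, i.e. all differences of elements stay distinct.
  On \<open>K\<^sub>3\<close> the only ruler with two marks in \<open>{0..3}\<close> that cannot be extended is \<open>{1, 2}\<close>, and Alice
  can always avoid it. On \<open>K\<^sub>4\<close> Bob plays 3, the midpoint of \<open>{0..6}\<close>, as soon as he can: a ruler
  through 3 with four marks in \<open>{0..6}\<close> would contain exactly one of \<open>3 - i\<close>, \<open>3 + i\<close> for each
  \<open>i = 1, 2, 3\<close>, and each of the eight choices repeats a difference.\<close>

section \<open>Golomb rulers\<close>

text \<open>The equation \<open>b + c = a + d\<close> says \<open>b - a = d - c\<close> without
  truncated subtraction. The conclusion \<open>a = c\<close> suffices, since \<open>b = d\<close>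
  then follows.\<close>

definition golomb :: "nat set \<Rightarrow> bool" where
  "golomb L \<longleftrightarrow> (\<forall>a\<in>L. \<forall>b\<in>L. \<forall>c\<in>L. \<forall>d\<in>L. a < b \<and> c < d \<and> b + c = a + d \<longrightarrow> a = c)"

lemma golombI:
  assumes "\<And>a b c d. \<lbrakk>a \<in> L; b \<in> L; c \<in> L; d \<in> L; a < b; c < d; b + c = a + d\<rbrakk> \<Longrightarrow> a = c"
  shows "golomb L"
  using assms unfolding golomb_def by blast

lemma golombD:
  "\<lbrakk>golomb L; a \<in> L; b \<in> L; c \<in> L; d \<in> L; a < b; c < d; b + c = a + d\<rbrakk> \<Longrightarrow> a = c"
  unfolding golomb_def by blast

lemma golomb_empty: "golomb {}"
  by (simp add: golomb_def)

lemma golomb_pair: "golomb {a, b}"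
  by (rule golombI) auto

text \<open>Legality with the graph forgotten: \<open>m\<close> stands for the number of edges,
  \<open>L\<close> for the used labels.\<close>

definition legal_label :: "nat \<Rightarrow> nat set \<Rightarrow> nat \<Rightarrow> bool" where
  "legal_label m L l \<longleftrightarrow> l \<le> m \<and> l \<notin> L \<and> golomb (insert l L)"

section \<open>Edge labels of complete graphs\<close>

lemma complete_graph_edges:
  assumes "complete_graph n G"
  shows "edges G = {e. e \<subseteq> verts G \<and> card e = 2}"
  using assms unfolding complete_graph_def simple_graph_def
  by (auto simp: card_2_iff)

lemma card_edges_complete_graph:
  assumes "complete_graph n G"
  shows "card (edges G) = n choose 2"
  using assms complete_graph_edges[OF assms] n_subsets[of "verts G" 2]
  by (simp add: complete_graph_def simple_graph_def)

lemma distinct_edge_labels_iff_golomb: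
  assumes G: "complete_graph n G" and U: "U \<subseteq> verts G" and inj: "inj_on f U"
  shows "distinct_edge_labels {e \<in> edges G. e \<subseteq> U} f \<longleftrightarrow> golomb (f ` U)"
proof -
  have E: "{u, v} \<in> {e \<in> edges G. e \<subseteq> U} \<longleftrightarrow> u \<in> U \<and> v \<in> U \<and> u \<noteq> v" for u v
    using U unfolding complete_graph_edges[OF G] by (auto simp: card_insert_if)
  have inj': "f u = f v \<longleftrightarrow> u = v" if "u \<in> U" "v \<in> U" for u v
    using inj that by (rule inj_on_eq_iff)
  show ?thesis
  proof
    assume D: "distinct_edge_labels {e \<in> edges G. e \<subseteq> U} f"
    show "golomb (f ` U)"
    proof (rule golombI)
      fix a b c d
      assume "a \<in> f ` U" "b \<in> f ` U" "c \<in> f ` U" "d \<in> f ` U"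
        and lt: "a < b" "c < d" "b + c = a + d"
      then obtain u v x y where uv: "u \<in> U" "v \<in> U" "x \<in> U" "y \<in> U"
        and f: "a = f u" "b = f v" "c = f x" "d = f y"
        by blast
      have "\<bar>int (f u) - int (f v)\<bar> = \<bar>int (f x) - int (f y)\<bar>"
        using lt f by linarith
      moreover have "u \<noteq> v" "x \<noteq> y"
        using lt f by auto
      ultimately have "{u, v} = {x, y}"
        using D E uv unfolding distinct_edge_labels_def by blast
      \<comment> \<open>The crossed matching \<open>u = y\<close>, \<open>v = x\<close> would give
        \<open>a = d\<close> and \<open>b = c\<close>, against \<open>a < b\<close> and
        \<open>c < d\<close>.\<close>
      then show "a = c"
        using f lt by (auto simp: doubleton_eq_iff)
    qed
  next
    assume "golomb (f ` U)"
    have key: "{u, v} = {x, y}"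
      if "u \<in> U" "v \<in> U" "x \<in> U" "y \<in> U" "f u < f v" "f x < f y" "f v + f x = f u + f y"
      for u v x y
    proof -
      have "f u = f x"
        using golombD[OF \<open>golomb (f ` U)\<close>, of "f u" "f v" "f x" "f y"] that by blast
      with that show ?thesis by (simp add: inj')
    qed
    show "distinct_edge_labels {e \<in> edges G. e \<subseteq> U} f"
      unfolding distinct_edge_labels_def E
    proof (intro allI impI notI, elim conjE)
      fix u v x y
      assume uv: "u \<in> U" "v \<in> U" "u \<noteq> v" "x \<in> U" "y \<in> U" "x \<noteq> y" "{u, v} \<noteq> {x, y}"
        and eq: "\<bar>int (f u) - int (f v)\<bar> = \<bar>int (f x) - int (f y)\<bar>"
      have "f u \<noteq> f v" "f x \<noteq> f y"
        using uv by (simp_all add: inj')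
      \<comment> \<open>Each edge is oriented from its smaller to its larger label, so that the
        absolute values open up and \<open>key\<close> applies.\<close>
      then consider "f u < f v" "f x < f y" | "f u < f v" "f y < f x"
        | "f v < f u" "f x < f y" | "f v < f u" "f y < f x"
        by linarith
      then show False
      proof cases
        case 1 then show False using key[of u v x y] uv eq by linarith
      next
        case 2 then show False using key[of u v y x] uv eq by (auto simp: insert_commute)
      next
        case 3 then show False using key[of v u x y] uv eq by (auto simp: insert_commute)
      next
        case 4 then show False using key[of v u y x] uv eq by (auto simp: insert_commute)
      qed
    qed
  qed
qed

section \<open>Positions described by their used labels\<close>

definition valid_position :: "'a graph \<Rightarrow> 'a position \<Rightarrow> bool" where
  "valid_position G p \<longleftrightarrow> dom p \<subseteq> verts G \<and> inj_on (the \<circ> p) (dom p) \<and>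
     ran p \<subseteq> {..card (edges G)} \<and> golomb (ran p)"

lemma image_the_dom: "(the \<circ> p) ` dom p = ran p"
  by (force simp: ran_def image_iff)

lemma inj_on_dom_upd:
  assumes "inj_on (the \<circ> p) (dom p)" "v \<notin> dom p" "l \<notin> ran p"
  shows "inj_on (the \<circ> p(v \<mapsto> l)) (dom (p(v \<mapsto> l)))"
proof -
  have "(the \<circ> p(v \<mapsto> l)) u = (if u = v then l else (the \<circ> p) u)" for u
    by simp
  moreover have "(the \<circ> p) u \<noteq> l" if "u \<in> dom p" for u
    using assms(3) that image_the_dom[of p] by blast
  ultimately show ?thesis
    using assms(1,2) unfolding inj_on_def dom_fun_upd by auto
qed

text \<open>This splits a move into a free choice of vertex and a condition on the label alone,
  which is what lets the game be played on label sets.\<close>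

lemma legal_move_iff_legal_label:
  assumes G: "complete_graph n G" and p: "valid_position G p"
  shows "legal_move G p (v, l) \<longleftrightarrow>
    v \<in> verts G - dom p \<and> legal_label (card (edges G)) (ran p) l"
proof (cases "v \<in> verts G - dom p \<and> l \<notin> ran p")
  case True
  let ?q = "p(v \<mapsto> l)"
  have "inj_on (the \<circ> ?q) (dom ?q)"
    using True p unfolding valid_position_def by (intro inj_on_dom_upd) auto
  moreover have "dom ?q \<subseteq> verts G"
    using True p by (auto simp: valid_position_def)
  moreover have "ran ?q = insert l (ran p)"
    using True by (intro ran_map_upd) auto
  ultimately have "distinct_edge_labels {e \<in> edges G. e \<subseteq> dom ?q} (the \<circ> ?q)
      \<longleftrightarrow> golomb (insert l (ran p))"
    using distinct_edge_labels_iff_golomb[OF G] image_the_dom[of ?q] by metis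
  with True show ?thesis
    by (auto simp: legal_move_def legal_label_def Let_def)
next
  case False
  then show ?thesis
    by (auto simp: legal_move_def legal_label_def)
qed

lemma valid_position_step:
  assumes G: "complete_graph n G" and p: "valid_position G p" and m: "legal_move G p (v, l)"
  shows "valid_position G (p(v \<mapsto> l))"
proof -
  have v: "v \<in> verts G" "v \<notin> dom p" and l: "l \<le> card (edges G)" "l \<notin> ran p"
    and g: "golomb (insert l (ran p))"
    using m unfolding legal_move_iff_legal_label[OF G p] legal_label_def by auto
  have r: "ran (p(v \<mapsto> l)) = insert l (ran p)"
    using v by (intro ran_map_upd) auto
  have "inj_on (the \<circ> p(v \<mapsto> l)) (dom (p(v \<mapsto> l)))"
    using v l p unfolding valid_position_def by (intro inj_on_dom_upd) auto
  then show ?thesis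
    using p v l g unfolding valid_position_def r by auto
qed

lemma card_ran_valid_position:
  assumes "valid_position G p"
  shows "card (ran p) = card (dom p)"
  using assms card_image[of "the \<circ> p" "dom p"] unfolding valid_position_def image_the_dom by blast

lemma valid_position_complete_iff:
  assumes G: "complete_graph n G" and p: "valid_position G p"
  shows "dom p = verts G \<longleftrightarrow> card (ran p) = n"
  using assms card_subset_eq[of "verts G" "dom p"] card_ran_valid_position[OF p]
  by (auto simp: complete_graph_def simple_graph_def valid_position_def)

lemma game_over_iff:
  assumes G: "complete_graph n G" and p: "valid_position G p"
  shows "game_over G p \<longleftrightarrow>
    card (ran p) = n \<or> (\<nexists>l. legal_label (card (edges G)) (ran p) l)"
proof -
  have "verts G - dom p = {} \<longleftrightarrow> dom p = verts G"
    using p by (auto simp: valid_position_def)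
  then show ?thesis
    using legal_move_iff_legal_label[OF assms] valid_position_complete_iff[OF assms]
    unfolding game_over_def split_paired_Ex by blast
qed

text \<open>A valid position that labels every vertex is already graceful, because its range is a
  Golomb ruler; so only the number of used labels decides.\<close>

lemma wins_iff:
  assumes G: "complete_graph n G" and p: "valid_position G p"
  shows "wins G p P \<longleftrightarrow> (P = Alice \<longleftrightarrow> card (ran p) = n)"
proof -
  have "graceful_labeling G (the \<circ> p)" if "dom p = verts G"
  proof -
    have "{e \<in> edges G. e \<subseteq> dom p} = edges G"
      using that complete_graph_edges[OF G] by auto
    then show ?thesis
      using p that distinct_edge_labels_iff_golomb[OF G, of "dom p" "the \<circ> p"]
      using image_the_dom[of p]
      by (auto simp: graceful_labeling_def valid_position_def)
  qed
  then show ?thesis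
    using valid_position_complete_iff[OF assms] by (cases P) auto
qed

section \<open>Winning strategies from invariants\<close>

lemma to_move_snoc: "to_move s (h @ [m]) = opponent (to_move s h)"
  by (cases s) (auto simp: to_move_def)

text \<open>The invariant \<open>I\<close> takes the player to move and the set of used labels.\<close>

lemma invariant_winning_strategy:
  fixes I :: "player \<Rightarrow> nat set \<Rightarrow> bool"
  assumes G: "complete_graph n G" and m: "m = card (edges G)"
    and init: "I s {}"
    and own: "\<And>L. \<lbrakk>I P L; golomb L; L \<subseteq> {..m}; card L \<noteq> n; \<exists>l. legal_label m L l\<rbrakk>
      \<Longrightarrow> \<exists>l. legal_label m L l \<and> I (opponent P) (insert l L)"
    and other: "\<And>L l. \<lbrakk>I (opponent P) L; golomb L; L \<subseteq> {..m}; legal_label m L l\<rbrakk>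
      \<Longrightarrow> I P (insert l L)"
    and final: "\<And>Q L. \<lbrakk>I Q L; golomb L; L \<subseteq> {..m}; card L = n \<or> (\<nexists>l. legal_label m L l)\<rbrakk>
      \<Longrightarrow> P = Alice \<longleftrightarrow> card L = n"
  shows "has_winning_strategy G s P"
proof -
  let ?good = "\<lambda>h mv. legal_move G (map_of h) mv \<and>
    I (opponent P) (insert (snd mv) (ran (map_of h)))"
  \<comment> \<open>The strategy chooses any legal move that restores the invariant for the
    opponent; \<open>good\<close> shows that one exists in each unfinished valid position satisfying
    \<open>I P\<close>.\<close>
  define \<sigma> where "\<sigma> h = (SOME mv. ?good h mv)" for h
  have valid: "golomb (ran p)" "ran p \<subseteq> {..m}" if "valid_position G p" for p :: "'a position"
    using that m by (auto simp: valid_position_def)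
  have good: "?good h (\<sigma> h)"
    if h: "valid_position G (map_of h)" "I P (ran (map_of h))" "\<not> game_over G (map_of h)" for h
  proof -
    let ?p = "map_of h"
    from h have ne: "card (ran ?p) \<noteq> n" "\<exists>l. legal_label m (ran ?p) l"
      using game_over_iff[OF G h(1)] m by auto
    then obtain l where l: "legal_label m (ran ?p) l" "I (opponent P) (insert l (ran ?p))"
      using own[OF h(2) valid[OF h(1)]] by blast
    \<comment> \<open>Any free vertex will do, since \<open>I\<close> and \<open>legal_label\<close>
      see only the label.\<close>
    obtain v where "v \<in> verts G - dom ?p"
      using ne(1) h(1) valid_position_complete_iff[OF G h(1)] by (auto simp: valid_position_def)
    then have "?good h (v, l)"
      using l m by (simp add: legal_move_iff_legal_label[OF G h(1)])
    then show ?thesis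
      unfolding \<sigma>_def by (rule someI)
  qed
  have inv: "valid_position G (map_of h) \<and> I (to_move s h) (ran (map_of h))"
    if "consistent_play G s P \<sigma> h" for h
    using that
  proof induction
    case start
    then show ?case
      using init by (simp add: valid_position_def golomb_empty to_move_def)
  next
    case (step h mv)
    obtain v l where mv: "mv = (v, l)" by fastforce
    let ?p = "map_of h"
    have p: "valid_position G ?p" and Ip: "I (to_move s h) (ran ?p)"
      using step.IH by auto
    have vl: "v \<notin> dom ?p" "legal_label m (ran ?p) l"
      using step.hyps(2) mv m by (auto simp: legal_move_iff_legal_label[OF G p])
    \<comment> \<open>\<open>map_of\<close> prefers earlier entries, so appending a move acts as an
      update because \<open>v\<close> is still free.\<close>
    have q: "map_of (h @ [mv]) = ?p(v \<mapsto> l)"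
      using vl(1) mv by (auto simp: fun_eq_iff map_add_def split: option.split)
    have r: "ran (?p(v \<mapsto> l)) = insert l (ran ?p)"
      using vl by (intro ran_map_upd) auto
    have "I (opponent (to_move s h)) (insert l (ran ?p))"
    proof (cases "to_move s h = P")
      case True
      have "\<not> game_over G ?p"
        using step.hyps(2) unfolding game_over_def by blast
      then show ?thesis
        using good[OF p] Ip True step.hyps(3) mv by (metis snd_conv)
    next
      case False
      then have "to_move s h = opponent P" "opponent (to_move s h) = P"
        by (cases P; cases "to_move s h"; simp)+
      then show ?thesis
        using other[OF _ valid[OF p] vl(2)] Ip by simp
    qed
    then show ?case
      using valid_position_step[OF G p] step.hyps(2)
      unfolding q r to_move_snoc unfolding mv by blast
  qed
  have "winning_strategy G s P \<sigma>"
    unfolding winning_strategy_def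
  proof (intro allI impI)
    fix h assume "consistent_play G s P \<sigma> h"
    then have p: "valid_position G (map_of h)" and Ip: "I (to_move s h) (ran (map_of h))"
      using inv by auto
    show "if game_over G (map_of h) then wins G (map_of h) P
      else to_move s h = P \<longrightarrow> legal_move G (map_of h) (\<sigma> h)"
      using good[OF p] Ip final[OF Ip valid[OF p]] wins_iff[OF G p] game_over_iff[OF G p] m
      by auto
  qed
  then show ?thesis
    unfolding has_winning_strategy_def by blast
qed

section \<open>Rulers in \<open>{0..3}\<close> and \<open>{0..6}\<close>\<close>

lemma subset_atMost_3_cases:
  assumes "L \<subseteq> {..3::nat}"
  shows "L \<in> {{}, {0}, {1}, {2}, {3}, {0,1}, {0,2}, {0,3}, {1,2}, {1,3}, {2,3},
    {0,1,2}, {0,1,3}, {0,2,3}, {1,2,3}, {0,1,2,3}}"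
proof -
  have "{..3::nat} = {0, 1, 2, 3}" by auto
  then have "L \<in> Pow {0, 1, 2, 3}" using assms by simp
  then show ?thesis
    by (simp add: Pow_insert insert_commute)
qed

text \<open>Alice can always move to a set containing 0: she plays 0 if it is free, otherwise 3, and
  1 from \<open>{0, 3}\<close>. The clause on \<open>card L = 0\<close> fixes her opening move. The
  lemma also shows that \<open>{1, 2}\<close> is the only dead end.\<close>

lemma legal_label_3_exists:
  assumes "golomb L" "L \<subseteq> {..3}" "card L \<noteq> 3" "L \<noteq> {1, 2}"
  shows "\<exists>l. legal_label 3 L l \<and> (card L = 0 \<longrightarrow> l = 0) \<and> insert l L \<noteq> {1, 2}"
proof -
  \<comment> \<open>Containing 0 replaces \<open>insert l L \<noteq> {1, 2}\<close> as a stronger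
    condition that is easier to check.\<close>
  define ok where "ok L \<longleftrightarrow> (\<exists>l. legal_label 3 L l \<and> (card L = 0 \<longrightarrow> l = 0) \<and> 0 \<in> insert l L)"
    for L
  have okI: "ok L" if "legal_label 3 L l" "card L = 0 \<longrightarrow> l = 0" "0 \<in> insert l L" for L l
    unfolding ok_def by (intro exI conjI; fact that)
  have "ok {}" "ok {1}" "ok {2}" "ok {3}" "ok {1, 3}" "ok {2, 3}"
    by (rule okI[where l = 0]; simp add: legal_label_def golomb_def)+
  moreover have "ok {0}" "ok {0, 1}" "ok {0, 2}"
    by (rule okI[where l = 3]; simp add: legal_label_def golomb_def)+
  moreover have "ok {0, 3}"
    by (rule okI[where l = 1]; simp add: legal_label_def golomb_def)
  moreover have "\<not> golomb {0, 1, 2, 3}"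
    by (simp add: golomb_def)
  moreover have "card {0, 1, 2::nat} = 3" "card {0, 1, 3::nat} = 3" "card {0, 2, 3::nat} = 3"
    "card {1, 2, 3::nat} = 3"
    by simp_all
  ultimately have "ok L"
    using subset_atMost_3_cases[OF assms(2)] assms(1,3,4) unfolding insert_iff empty_iff
    by metis
  then obtain l where "legal_label 3 L l" "card L = 0 \<longrightarrow> l = 0" "0 \<in> insert l L"
    unfolding ok_def by metis
  moreover have "0 \<notin> {1, 2::nat}" by simp
  ultimately show ?thesis by metis
qed

text \<open>Once 3 is used, the labeling of K_4 cannot be completed, so Bob only has to get 3
  played.\<close>

lemma golomb_atMost_6_card:
  assumes g: "golomb L" and L: "L \<subseteq> {..6}" and "3 \<in> L"
  shows "card L < 4"
proof -
  have no: "\<not> (a \<in> L \<and> b \<in> L \<and> c \<in> L \<and> d \<in> L)"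
    if "a < b" "c < d" "b + c = a + d" "a \<noteq> c" for a b c d
    using golombD[OF g, of a b c d] that by blast
  \<comment> \<open>The first three facts exclude mirror images about 3. Of the eight choices of one
    mark from each mirror pair, \<open>{1, 2}\<close> and \<open>{4, 5}\<close> rule out two each
    and the four triples one each.\<close>
  have "\<not> (0 \<in> L \<and> 6 \<in> L)" "\<not> (1 \<in> L \<and> 5 \<in> L)" "\<not> (2 \<in> L \<and> 4 \<in> L)"
    "\<not> (1 \<in> L \<and> 2 \<in> L)" "\<not> (4 \<in> L \<and> 5 \<in> L)"
    "\<not> (0 \<in> L \<and> 1 \<in> L \<and> 4 \<in> L)" "\<not> (0 \<in> L \<and> 2 \<in> L \<and> 5 \<in> L)"
    "\<not> (6 \<in> L \<and> 2 \<in> L \<and> 5 \<in> L)" "\<not> (6 \<in> L \<and> 1 \<in> L \<and> 4 \<in> L)"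
    using \<open>3 \<in> L\<close> no[of 0 3 3 6] no[of 1 3 3 5] no[of 2 3 3 4] no[of 1 2 2 3] no[of 3 4 4 5]
      no[of 0 1 3 4] no[of 0 2 3 5] no[of 2 3 5 6] no[of 1 3 4 6]
    by auto
  \<comment> \<open>Counting by indicators makes the bound a propositional check on seven
    memberships.\<close>
  moreover have "card L = (\<Sum>i\<le>6. of_bool (i \<in> L))"
  proof -
    have "L = {..6} \<inter> L" using L by blast
    then show ?thesis by (simp add: sum_of_bool_eq Int_def)
  qed
  then have "card L = of_bool (0 \<in> L) + of_bool (1 \<in> L) + of_bool (2 \<in> L) + of_bool (3 \<in> L)
      + of_bool (4 \<in> L) + of_bool (5 \<in> L) + of_bool (6 \<in> L)"
    by (simp add: eval_nat_numeral)
  ultimately show ?thesis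
    by (auto simp: of_bool_def split: if_splits)
qed

section \<open>The games on K_3 and K_4\<close>

lemma Alice_wins_K3:
  assumes G: "complete_graph 3 G"
  shows "has_winning_strategy G s Alice"
proof -
  \<comment> \<open>Bob can make \<open>{1, 2}\<close> in one move only from a single label 1 or 2,
    so a single label left to him has to be 0. This matters when Alice starts; if Bob starts, Alice
    chooses the second label.\<close>
  define I where "I Q L \<longleftrightarrow> L \<noteq> {1, 2} \<and> (Q = Bob \<and> card L = 1 \<longrightarrow> L = {0})"
    for Q and L :: "nat set"
  have m: "3 = card (edges G)"
    using card_edges_complete_graph[OF G] by (simp add: eval_nat_numeral)
  have fin: "finite L" if "L \<subseteq> {..3}" for L :: "nat set"
    using that finite_subset by blast
  show ?thesis
  proof (rule invariant_winning_strategy[where I = I, OF G m])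
    show "I s {}"
      by (auto simp: I_def)
  next
    fix L assume L: "I Alice L" "golomb L" "L \<subseteq> {..3}" "card L \<noteq> 3"
    have "L \<noteq> {1, 2}"
      using L(1) by (simp add: I_def)
    then obtain l where "legal_label 3 L l" "card L = 0 \<longrightarrow> l = 0" "insert l L \<noteq> {1, 2}"
      using legal_label_3_exists[OF L(2-4)] by metis
    \<comment> \<open>One label after her move means that \<open>L\<close> was empty, hence
      \<open>l = 0\<close>.\<close>
    moreover from this have "card (insert l L) = 1 \<longrightarrow> insert l L = {0}"
      using fin[OF L(3)] by (simp add: legal_label_def)
    ultimately show "\<exists>l. legal_label 3 L l \<and> I (opponent Alice) (insert l L)"
      unfolding I_def by metis
  next
    fix L l assume L: "I (opponent Alice) L" "L \<subseteq> {..3}" and l: "legal_label 3 L l"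
    have "insert l L \<noteq> {1, 2}"
    proof
      assume eq: "insert l L = {1, 2}"
      have "card (insert l L) = Suc (card L)"
        using l fin[OF L(2)] by (simp add: legal_label_def)
      moreover have "card {1, 2::nat} = Suc 1"
        by simp
      ultimately have "card L = 1"
        unfolding eq by linarith
      then have "0 \<in> insert l L"
        using L(1) by (simp add: I_def)
      then show False
        unfolding eq by simp
    qed
    then show "I Alice (insert l L)"
      by (simp add: I_def)
  next
    fix Q L
    assume "I Q L" and L: "golomb L" "L \<subseteq> {..3}" "card L = 3 \<or> (\<nexists>l. legal_label 3 L l)"
    then have "L \<noteq> {1, 2}"
      by (simp add: I_def)
    then show "Alice = Alice \<longleftrightarrow> card L = 3"
      using legal_label_3_exists[of L] L by metis
  qed
qed

lemma Bob_wins_K4: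
  assumes G: "complete_graph 4 G"
  shows "has_winning_strategy G s Bob"
proof -
  define I where "I Q L \<longleftrightarrow> 3 \<in> L \<or> L = {} \<or> Q = Bob \<and> card L = 1"
    for Q and L :: "nat set"
  have m: "6 = card (edges G)"
    using card_edges_complete_graph[OF G] by (simp add: eval_nat_numeral)
  show ?thesis
  proof (rule invariant_winning_strategy[where I = I, OF G m])
    show "I s {}"
      by (simp add: I_def)
  next
    fix L assume L: "I Bob L" and ex: "\<exists>l. legal_label 6 L l"
    show "\<exists>l. legal_label 6 L l \<and> I (opponent Bob) (insert l L)"
    proof (cases "3 \<in> L")
      case True
      then show ?thesis using ex by (auto simp: I_def)
    next
      case False
      then have "legal_label 6 L 3"
        \<comment> \<open>The instance with both marks 3 covers the empty \<open>L\<close>, where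
          Bob opens.\<close>
        using L golomb_pair[of 3] golomb_pair[of 3 3]
        by (auto simp: I_def legal_label_def card_1_singleton_iff)
      then show ?thesis by (auto simp: I_def)
    qed
  next
    fix L l assume "I (opponent Bob) L"
    then show "I Bob (insert l L)"
      by (auto simp: I_def)
  next
    fix Q L assume "I Q L" "golomb L" "L \<subseteq> {..6}"
    \<comment> \<open>If 3 is not in \<open>L\<close>, then \<open>I\<close> leaves at most one
      label.\<close>
    then have "card L < 4"
      using golomb_atMost_6_card by (auto simp: I_def)
    then show "Bob = Alice \<longleftrightarrow> card L = 4"
      by simp
  qed
qed

theorem theorem2:
  fixes K3 :: "'a graph" and K4 :: "'b graph"
  assumes "complete_graph 3 K3" and "complete_graph 4 K4"
  shows "(\<forall>starter. has_winning_strategy K3 starter Alice) \<and>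
         (\<forall>starter. has_winning_strategy K4 starter Bob)"
  by (intro conjI allI Alice_wins_K3[OF assms(1)] Bob_wins_K4[OF assms(2)])

end
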